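(* Let $\mathcal{B}$ be a prime Banach algebra over $\mathbb{R}$ or $\mathbb{C}$, and let $\mathcal{H}_1,\mathcal{H}_2$ be non-empty open subsets of $\mathcal{B}$. Suppose $\mathcal{B}$ admits a continuous automorphism $f$ such that for every $(x,y)\in\mathcal{H}_1\times\mathcal{H}_2$ there exist positive integers $p=p(x,y)$, $q=q(x,y)$ with $$f(x^{p}y^{q})-x^{p}\circ y^{q}\in Z(\mathcal{B}).$$ Then $\mathcal{B}$ is commutative.
   Context: $Z(\mathcal{B})$ denotes the center of $\mathcal{B}$. For $x,y\in\mathcal{B}$, $x\circ y=xy+yx$ and $[x,y]=xy-yx$. $\mathcal{B}$ is prime if $x\mathcal{B}y=\{0\}$ implies $x=0$ or $y=0$. An automorphism of $\mathcal{B}$ is a bijective map $f:\mathcal{B}\to\mathcal{B}$ with $f(x+y)=f(x)+f(y)$ and $f(xy)=f(x)f(y)$ for all $x,y$. *)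

theory Defs
  imports "HOL-Analysis.Analysis"
begin

text \<open>Positive powers in a possibly non-unital ring: ppow x n = x^n for n \<ge> 1
  (the value at n = 0 is irrelevant and fixed to 0).\<close>
fun ppow :: "'a::ring \<Rightarrow> nat \<Rightarrow> 'a" where
  "ppow x 0 = 0"
| "ppow x (Suc 0) = x"
| "ppow x (Suc (Suc n)) = x * ppow x (Suc n)"

definition center :: "'a::ring set" where
  "center = {z. \<forall>x. z * x = x * z}"

definition jordan_prod :: "'a::ring \<Rightarrow> 'a \<Rightarrow> 'a" where
  "jordan_prod x y = x * y + y * x"

definition prime_ring :: "'a::ring itself \<Rightarrow> bool" where
  "prime_ring _ \<longleftrightarrow> (\<forall>x y :: 'a. (\<forall>b. x * b * y = 0) \<longrightarrow> x = 0 \<or> y = 0)"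

definition is_automorphism :: "('a::ring \<Rightarrow> 'a) \<Rightarrow> bool" where
  "is_automorphism f \<longleftrightarrow> bij f \<and> (\<forall>x y. f (x + y) = f x + f y) \<and> (\<forall>x y. f (x * y) = f x * f y)"

end

theory Submission
  imports Defs
begin

text \<open>By Baire's theorem the exponents \<open>p\<close>, \<open>q\<close> can be taken constant on an open box. Since \<open>f\<close> is
  real-linear, the condition is polynomial along lines, so it holds for all \<open>x\<close>, \<open>y\<close> with these
  exponents. With \<open>N = p q\<close>, exchanging the roles of \<open>x\<close> and \<open>y\<close> cancels the symmetric Jordan
  product: \<open>f [x\<^sup>N, y\<^sup>N]\<close>, and therefore \<open>[x\<^sup>N, y\<^sup>N]\<close>, is central. As \<open>[r, x\<^sup>N]\<close> is a directional
  derivative of the \<open>N\<close>-th power, also \<open>[[r, x\<^sup>N], x\<^sup>N]\<close> is central, and primeness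
  forces \<open>x\<^sup>N\<close> to be central. Differentiating once more at \<open>x\<close> in direction \<open>x\<^sup>2\<close> shows that
  \<open>x\<^sup>N\<^sup>+\<^sup>1\<close> is central, so every non-central \<open>x\<close> satisfies \<open>x\<^sup>N = 0\<close>. If there is one, this identity
  extends to the whole algebra by density, which is impossible in a nonzero prime ring.\<close>

text \<open>Additivity alone gives homogeneity over the rationals; the defect
  \<open>f (q *\<^sub>R x) - q *\<^sub>R f x\<close> is continuous in \<open>q\<close>, so it
  vanishes on their closure, the real line.\<close>

lemma linear_continuous_additive:
  fixes f :: "'a::real_normed_vector \<Rightarrow> 'b::real_normed_vector"
  assumes add: "\<And>x y. f (x + y) = f x + f y" and cont: "continuous_on UNIV f"
  shows "linear f"
proof (rule linearI)
  fix r :: real and x :: 'a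
  have zero: "f 0 = 0" using add[of 0 0] by simp
  have minus: "f (- y) = - f y" for y
    using add[of y "- y"] zero by (simp add: eq_neg_iff_add_eq_0 add.commute)
  have nat: "f (real n *\<^sub>R y) = real n *\<^sub>R f y" for n y
    by (induction n) (simp_all add: zero add scaleR_add_left)
  have int: "f (real_of_int k *\<^sub>R y) = real_of_int k *\<^sub>R f y" for k y
    by (cases k rule: int_cases2) (simp_all add: nat minus)
  have rat: "f (q *\<^sub>R x) - q *\<^sub>R f x = 0" if rational: "q \<in> \<rat>" for q :: real
  proof -
    obtain a b :: int where q: "q = real_of_int a / real_of_int b" "b \<noteq> 0"
      using Rats_cases'[OF rational] by (metis less_irrefl)
    have "real_of_int b *\<^sub>R f (q *\<^sub>R x) = real_of_int a *\<^sub>R f x"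
      using int[of b "q *\<^sub>R x"] int[of a x] q by simp
    then have "(1 / real_of_int b) *\<^sub>R (real_of_int b *\<^sub>R f (q *\<^sub>R x)) = q *\<^sub>R f x"
      using q by simp
    then show ?thesis using q by simp
  qed
  have "continuous_on (closure \<rat>) (\<lambda>q. f (q *\<^sub>R x) - q *\<^sub>R f x)"
    by (intro continuous_intros continuous_on_compose2[OF cont]) auto
  from continuous_constant_on_closure[OF this rat, of r]
  show "f (r *\<^sub>R x) = r *\<^sub>R f x"
    by (simp add: Rats_closure_real)
qed (rule add)

subsection \<open>Polynomial curves\<close>

text \<open>Vector-valued polynomials in Horner form: each induction step peels off the constant
  term.\<close>

inductive poly_curve :: "(real \<Rightarrow> 'a::real_normed_vector) \<Rightarrow> bool" where
  const: "poly_curve (\<lambda>t. c)"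
| step: "poly_curve g \<Longrightarrow> poly_curve (\<lambda>t. c + t *\<^sub>R g t)"

lemma poly_curve_continuous: "poly_curve g \<Longrightarrow> isCont g t"
proof (induction rule: poly_curve.induct)
  case (step g c)
  then show ?case by (intro isCont_add isCont_scaleR continuous_const continuous_ident)
qed simp

lemma poly_curve_linear:
  assumes "linear h" "poly_curve g"
  shows "poly_curve (\<lambda>t. h (g t))"
  using assms(2)
proof induction
  case (step g c)
  from poly_curve.step[OF step.IH, of "h c"] show ?case
    by (simp add: linear_add[OF assms(1)] linear_cmul[OF assms(1)])
qed (rule poly_curve.const)

lemma poly_curve_add:
  assumes "poly_curve g" "poly_curve h"
  shows "poly_curve (\<lambda>t. g t + h t)"
  using assms
proof (induction arbitrary: h rule: poly_curve.induct)
  case (const c)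
  from const show ?case
  proof (cases rule: poly_curve.cases)
    case (step g d)
    then show ?thesis
      using poly_curve.step[OF step(2), of "c + d"] by (simp add: add.assoc)
  qed (auto intro: poly_curve.const)
next
  case (step g c)
  from step.prems show ?case
  proof (cases rule: poly_curve.cases)
    case (const d)
    then show ?thesis
      using poly_curve.step[OF step(1), of "c + d"] by (simp add: algebra_simps)
  next
    case (step k d)
    then show ?thesis
      using poly_curve.step[OF step.IH[OF step(2)], of "c + d"] by (simp add: algebra_simps)
  qed
qed

lemma poly_curve_mult:
  fixes g h :: "real \<Rightarrow> 'a::real_normed_algebra"
  assumes "poly_curve g" "poly_curve h"
  shows "poly_curve (\<lambda>t. g t * h t)"
  using assms(1)
proof induction
  case (const c)
  have "linear (\<lambda>x. c * x)" by (intro linearI) (simp_all add: distrib_left)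
  from poly_curve_linear[OF this assms(2)] show ?case .
next
  case (step g c)
  have "linear (\<lambda>x. c * x)" by (intro linearI) (simp_all add: distrib_left)
  from poly_curve_add[OF poly_curve_linear[OF this assms(2)] poly_curve.step[OF step.IH, of 0]]
  show ?case by (simp add: distrib_right)
qed

lemma poly_curve_ppow:
  fixes g :: "real \<Rightarrow> 'a::real_normed_algebra"
  assumes "poly_curve g"
  shows "poly_curve (\<lambda>t. ppow (g t) n)"
proof (induction n rule: induct_nat_012)
  case (ge2 n)
  then show ?case by (simp add: poly_curve_mult assms)
qed (simp_all add: poly_curve.const assms)

lemma poly_curve_line: "poly_curve (\<lambda>t. a + t *\<^sub>R b)"
  by (rule poly_curve.step[OF poly_curve.const])

lemma poly_curve_diff:
  fixes g h :: "real \<Rightarrow> 'a::real_normed_vector"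
  assumes "poly_curve g" "poly_curve h"
  shows "poly_curve (\<lambda>t. g t - h t)"
proof -
  have "linear (uminus :: 'a \<Rightarrow> 'a)" by (intro linearI) simp_all
  from poly_curve_add[OF assms(1) poly_curve_linear[OF this assms(2)]] show ?thesis by simp
qed

lemma closed_tendsto_at:
  fixes g :: "real \<Rightarrow> 'a::real_normed_vector"
  assumes W: "closed W" and g: "(g \<longlongrightarrow> l) (at 0)"
    and e: "e > 0" and mem: "\<And>t. t \<noteq> 0 \<Longrightarrow> \<bar>t\<bar> < e \<Longrightarrow> g t \<in> W"
  shows "l \<in> W"
proof (rule Lim_in_closed_set[OF W _ _ g])
  show "\<forall>\<^sub>F t in at 0. g t \<in> W"
    unfolding eventually_at using e mem by (auto simp: dist_real_def)
qed simp

text \<open>Identity principle modulo \<open>W\<close>: the constant term is the value at 0. After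
  subtracting it and dividing by \<open>t\<close>, the remaining factor lies in \<open>W\<close> for
  small nonzero \<open>t\<close>, and at 0 by closedness, so induction applies.\<close>

lemma poly_curve_in_closed_subspace:
  assumes W: "closed W" "subspace W" and e: "e > 0"
    and "poly_curve g" and "\<And>t. \<bar>t\<bar> < e \<Longrightarrow> g t \<in> W"
  shows "g t \<in> W"
  using assms(4,5)
proof (induction arbitrary: t rule: poly_curve.induct)
  case (const c)
  then show ?case using e by (metis abs_zero)
next
  case (step g c)
  have c: "c \<in> W" using step.prems[of 0] e by simp
  have ne: "g t \<in> W" if "t \<noteq> 0" "\<bar>t\<bar> < e" for t
  proof -
    have "(1 / t) *\<^sub>R ((c + t *\<^sub>R g t) - c) \<in> W"
      using that step.prems c W(2) by (intro subspace_scale subspace_diff) auto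
    then show ?thesis using that by simp
  qed
  have "g 0 \<in> W"
    using closed_tendsto_at[OF W(1) _ e ne] poly_curve_continuous[OF step(1), of 0]
    by (simp add: isCont_def)
  with ne have "g t \<in> W" if "\<bar>t\<bar> < e" for t
    using that by (cases "t = 0") auto
  then have "g t \<in> W" for t by (rule step.IH)
  then show ?case using c W(2) by (intro subspace_add subspace_scale) auto
qed

subsection \<open>Powers and their derivatives\<close>

lemma ppow_Suc: "n > 0 \<Longrightarrow> ppow x (Suc n) = x * ppow x n"
  by (cases n) simp_all

lemma ppow_add: "m > 0 \<Longrightarrow> n > 0 \<Longrightarrow> ppow x (m + n) = ppow x m * ppow x n"
proof (induction m rule: nat_induct_non_zero)
  case (Suc m)
  then show ?case by (simp add: ppow_Suc mult.assoc)
qed (simp add: ppow_Suc)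

lemma ppow_ppow: "n > 0 \<Longrightarrow> m > 0 \<Longrightarrow> ppow (ppow x m) n = ppow x (m * n)"
proof (induction n rule: nat_induct_non_zero)
  case (Suc n)
  then show ?case by (simp add: ppow_Suc ppow_add)
qed simp

lemma continuous_on_ppow [continuous_intros]:
  fixes g :: "'b::topological_space \<Rightarrow> 'a::real_normed_algebra"
  assumes "continuous_on S g"
  shows "continuous_on S (\<lambda>x. ppow (g x) n)"
proof (induction n rule: induct_nat_012)
  case (ge2 n)
  from continuous_on_mult[OF assms ge2(2)] show ?case by simp
qed (simp_all add: assms)

text \<open>\<open>dpow x y n\<close> is the derivative of the power \<open>n + 1\<close> at \<open>x\<close> in direction \<open>y\<close>,
  that is, the sum of all \<open>x\<^sup>i y x\<^sup>j\<close> with \<open>i + j = n\<close>.\<close>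
fun dpow :: "'a::ring \<Rightarrow> 'a \<Rightarrow> nat \<Rightarrow> 'a" where
  "dpow x y 0 = y"
| "dpow x y (Suc n) = y * ppow x (Suc n) + x * dpow x y n"

text \<open>All summands of the derivative coincide in a commuting direction. The case
  \<open>n = 0\<close> would fail because \<open>ppow x 0\<close> is 0.\<close>

lemma dpow_commute:
  fixes x y :: "'a::real_normed_algebra"
  assumes "x * y = y * x" "n > 0"
  shows "dpow x y n = real (Suc n) *\<^sub>R (ppow x n * y)"
proof -
  have comm: "ppow x k * y = y * ppow x k" for k
  proof (induction k rule: induct_nat_012)
    case (ge2 k)
    then show ?case by (metis assms(1) mult.assoc ppow.simps(3))
  qed (simp_all add: assms)
  from assms(2) show ?thesis
  proof (induction n rule: nat_induct_non_zero)
    case 1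
    then show ?case using assms(1) by (simp add: scaleR_2)
  next
    case (Suc n)
    have "dpow x y (Suc n) = y * ppow x (Suc n) + x * dpow x y n" by simp
    also have "\<dots> = ppow x (Suc n) * y + real (Suc n) *\<^sub>R (ppow x (Suc n) * y)"
      unfolding Suc.IH comm[of "Suc n", symmetric]
      by (simp add: ppow_Suc[OF Suc.hyps] mult.assoc)
    also have "\<dots> = real (Suc (Suc n)) *\<^sub>R (ppow x (Suc n) * y)"
      by (simp add: scaleR_add_left scaleR_2)
    finally show ?case .
  qed
qed

text \<open>Commutation with \<open>r\<close> is a derivation, so the Leibniz rule makes it act on a
  power as the derivative in direction \<open>r * x - x * r\<close>.\<close>

lemma commutator_ppow:
  "r * ppow x (Suc n) - ppow x (Suc n) * r = dpow x (r * x - x * r) n"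
proof (induction n)
  case (Suc n)
  have "r * ppow x (Suc (Suc n)) - ppow x (Suc (Suc n)) * r
      = (r * x - x * r) * ppow x (Suc n) + x * (r * ppow x (Suc n) - ppow x (Suc n) * r)"
    by (simp add: algebra_simps)
  then show ?case by (simp only: Suc.IH dpow.simps)
qed simp

lemma has_vector_derivative_ppow_line:
  fixes x y :: "'a::real_normed_algebra"
  shows "((\<lambda>t. ppow (x + t *\<^sub>R y) (Suc n)) has_vector_derivative dpow x y n) (at 0)"
proof (induction n)
  have line: "((\<lambda>t. x + t *\<^sub>R y) has_vector_derivative y) (at 0)"
    by (auto intro!: derivative_eq_intros)
  case 0
  then show ?case using line by simp
  case (Suc n)
  from has_vector_derivative_mult[OF line Suc.IH] show ?case
    by (simp add: add.commute)
qed

text \<open>The difference quotients of the power stay in the subspace, and closedness keeps their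
  limit there.\<close>

lemma dpow_in_closed_subspace:
  fixes W :: "'a::real_normed_algebra set"
  assumes W: "closed W" "subspace W" and pow: "\<And>x. ppow x (Suc n) \<in> W"
  shows "dpow x y n \<in> W"
proof -
  let ?g = "\<lambda>t. ppow (x + t *\<^sub>R y) (Suc n)"
  have "((\<lambda>t. (1 / t) *\<^sub>R (?g t - ?g 0)) \<longlongrightarrow> dpow x y n) (at 0)"
  proof (rule LIM_zero_cancel, rule tendsto_norm_zero_cancel)
    have "((\<lambda>t. norm (?g t - ?g 0 - t *\<^sub>R dpow x y n) / norm t) \<longlongrightarrow> 0) (at 0)"
      using has_vector_derivative_ppow_line[of x y n]
      unfolding has_vector_derivative_def has_derivative_at by simp
    moreover have "norm (?g t - ?g 0 - t *\<^sub>R dpow x y n) / norm t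
        = norm ((1 / t) *\<^sub>R (?g t - ?g 0) - dpow x y n)" if "t \<noteq> 0" for t
    proof -
      have "norm ((1 / t) *\<^sub>R (?g t - ?g 0) - dpow x y n)
          = norm ((1 / t) *\<^sub>R (?g t - ?g 0 - t *\<^sub>R dpow x y n))"
        using that by (simp add: scaleR_diff_right)
      then show ?thesis by simp
    qed
    ultimately show "((\<lambda>t. norm ((1 / t) *\<^sub>R (?g t - ?g 0) - dpow x y n)) \<longlongrightarrow> 0) (at 0)"
      by (auto elim!: Lim_transform_eventually simp: eventually_at_filter)
  qed
  from closed_tendsto_at[OF W(1) this zero_less_one]
  show ?thesis
    using pow W(2) by (auto intro!: subspace_scale subspace_diff)
qed

subsection \<open>Prime rings\<close>

lemma prime_ringD:
  fixes x y :: "'a::ring"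
  assumes "prime_ring TYPE('a)" "\<And>b. x * b * y = 0"
  shows "x = 0 \<or> y = 0"
  using assms(1)[unfolded prime_ring_def, rule_format, of x y] assms(2) by simp

lemma centerD: "z \<in> center \<Longrightarrow> z * x = x * z"
  by (simp add: center_def)

text \<open>Centrality of \<open>c\<close> and \<open>c * a\<close> gives
  \<open>c * (a * r - r * a) = 0\<close>; moving \<open>c\<close> past any \<open>b\<close> puts
  this in the form to which primeness applies.\<close>

lemma center_cancel:
  fixes c a :: "'a::ring"
  assumes prime: "prime_ring TYPE('a)" and c: "c \<in> center" "c \<noteq> 0" and ca: "c * a \<in> center"
  shows "a \<in> center"
proof -
  have "a * r - r * a = 0" for r
  proof -
    have "c * (a * r - r * a) = 0"
      using centerD[OF ca, of r] centerD[OF c(1), of r]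
      by (simp add: right_diff_distrib flip: mult.assoc)
    then have "c * b * (a * r - r * a) = 0" for b
      using centerD[OF c(1), of b] by (simp add: mult.assoc)
    then show ?thesis using prime_ringD[OF prime] c(2) by blast
  qed
  then show ?thesis by (simp add: center_def)
qed

lemma subspace_center: "subspace (center :: 'a::real_normed_algebra set)"
  by (simp add: subspace_def center_def distrib_left distrib_right)

lemma closed_center: "closed (center :: 'a::real_normed_algebra set)"
proof -
  have eq: "center = (\<Inter>x::'a. {z. z * x = x * z})" by (auto simp: center_def)
  show ?thesis
    unfolding eq by (intro closed_INT ballI closed_Collect_eq continuous_intros)
qed

text \<open>The inner derivation by \<open>a\<close> squares to zero, so by Leibniz \<open>2 d(x) d(y) = 0\<close>;
  replacing \<open>y\<close> by \<open>y x\<close> gives \<open>d(x) y d(x) = 0\<close>.\<close>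
lemma double_commutator_zero:
  fixes a :: "'a::real_normed_algebra"
  assumes prime: "prime_ring TYPE('a)"
    and "\<And>r. (r * a - a * r) * a - a * (r * a - a * r) = 0"
  shows "a \<in> center"
proof -
  define d where "d = (\<lambda>r. r * a - a * r)"
  have dd: "d (d r) = 0" for r using assms(2) by (simp add: d_def)
  have leib: "d (x * y) = d x * y + x * d y" for x y by (simp add: d_def algebra_simps)
  have dadd: "d (x + y) = d x + d y" for x y by (simp add: d_def algebra_simps)
  have dxdy: "d x * d y = 0" for x y
  proof -
    have "0 = d (d (x * y))" by (simp add: dd)
    also have "\<dots> = 2 *\<^sub>R (d x * d y)" by (simp add: leib dadd dd scaleR_2)
    finally show ?thesis by simp
  qed
  have "d x * y * d x = 0" for x y
    using dxdy[of x "y * x"] dxdy[of x y] by (simp add: leib distrib_left flip: mult.assoc)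
  then have "d x = 0" for x using prime_ringD[OF prime] by blast
  then show ?thesis by (simp add: d_def center_def)
qed

lemma double_commutator_center:
  fixes a :: "'a::real_normed_algebra"
  assumes prime: "prime_ring TYPE('a)"
    and dc: "\<And>r. (r * a - a * r) * a - a * (r * a - a * r) \<in> center"
  shows "a \<in> center"
proof (rule ccontr)
  assume a: "a \<notin> center"
  have "(r * a - a * r) * a - a * (r * a - a * r) = 0" for r
  proof (rule ccontr)
    assume "(r * a - a * r) * a - a * (r * a - a * r) \<noteq> 0"
    \<comment> \<open>Replacing \<open>r\<close> by \<open>r * a\<close> multiplies the double
      commutator by \<open>a\<close> on the right, so a nonzero central value could be cancelled to
      make \<open>a\<close> central.\<close>
    moreover have "((r * a - a * r) * a - a * (r * a - a * r)) * a \<in> center"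
      using dc[of "r * a"] by (simp add: algebra_simps)
    ultimately show False using center_cancel[OF prime dc] a by blast
  qed
  with double_commutator_zero[OF prime] a show False by blast
qed

lemma ppow_center_if_commutators_center:
  assumes prime: "prime_ring TYPE('a::real_normed_algebra)"
    and comm: "\<And>x y :: 'a. ppow x (Suc n) * ppow y (Suc n) - ppow y (Suc n) * ppow x (Suc n) \<in> center"
  shows "ppow (x::'a) (Suc n) \<in> center"
proof -
  define a where "a = ppow x (Suc n)"
  define W where "W = {w. w * a - a * w \<in> center}"
  have "linear (\<lambda>w. w * a - a * w)"
    by (intro linearI) (simp_all add: algebra_simps)
  from linear_subspace_vimage[OF this subspace_center]
  have sub: "subspace W" by (simp add: W_def vimage_def)
  have clo: "closed W"
    unfolding W_def
    by (intro closed_vimage[OF closed_center, unfolded vimage_def] continuous_intros)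
  \<comment> \<open>Since \<open>W\<close> is a closed subspace containing all these powers, it
    contains their derivatives, among them every commutator with \<open>a\<close>.\<close>
  have "ppow y (Suc n) \<in> W" for y
    unfolding W_def a_def using comm by simp
  from dpow_in_closed_subspace[OF clo sub this]
  have "r * a - a * r \<in> W" for r
    unfolding a_def commutator_ppow .
  then have "(r * a - a * r) * a - a * (r * a - a * r) \<in> center" for r
    by (simp add: W_def)
  then have "a \<in> center" by (rule double_commutator_center[OF prime])
  then show ?thesis by (simp add: a_def)
qed

text \<open>Multiplying the linearized identity \<open>dpow x y n = 0\<close> by \<open>x\<^sup>n\<close> on the left kills
  every term except \<open>x\<^sup>n y x\<^sup>n\<close>.\<close>
lemma nil_bounded_index_zero:
  assumes prime: "prime_ring TYPE('a::real_normed_algebra)"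
    and "\<And>x :: 'a. ppow x (Suc n) = 0"
  shows "(x :: 'a) = 0"
  using assms(2)
proof (induction n arbitrary: x)
  case (Suc n)
  have "dpow x y (Suc n) = 0" for x y :: 'a
    using dpow_in_closed_subspace[of "{0}" "Suc n" x y] Suc.prems by (simp add: subspace_def del: ppow.simps)
  then have "ppow x (Suc n) * (y * ppow x (Suc n) + x * dpow x y n) = 0" for x y :: 'a
    by simp
  moreover have "ppow x (Suc n) * x = 0" for x :: 'a
    using Suc.prems[of x] ppow_add[of "Suc n" 1 x] by simp
  ultimately have "ppow x (Suc n) * y * ppow x (Suc n) = 0" for x y :: 'a
    by (simp add: distrib_left del: ppow.simps flip: mult.assoc)
  then have "ppow x (Suc n) = 0" for x :: 'a
    using prime_ringD[OF prime] by blast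
  then show ?case by (rule Suc.IH)
qed simp

lemma commutative_if_ppow_center:
  assumes prime: "prime_ring TYPE('a::real_normed_algebra)"
    and cen: "\<And>x :: 'a. ppow x (Suc n) \<in> center"
  shows "(x :: 'a) \<in> center"
proof (rule ccontr)
  assume x: "x \<notin> center"
  have nil: "ppow u (Suc n) = 0" if u: "u \<notin> center" for u :: 'a
  proof (rule ccontr)
    assume nz: "ppow u (Suc n) \<noteq> 0"
    have "n > 0" using cen[of u] u by (cases n) auto
    \<comment> \<open>The direction \<open>u * u\<close> commutes with \<open>u\<close>, so the
      derivative is a multiple of the power \<open>n + 2\<close> of \<open>u\<close>, from which the
      nonzero central power \<open>n + 1\<close> can be cancelled.\<close>
    then have "real (Suc n) *\<^sub>R (ppow u n * (u * u)) \<in> center"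
      using dpow_in_closed_subspace[OF closed_center subspace_center cen, of u "u * u"]
      by (simp add: dpow_commute mult.assoc)
    from subspace_scale[OF subspace_center this, of "1 / real (Suc n)"]
    have "ppow u n * (u * u) \<in> center" by simp
    then have "ppow u (Suc n) * u \<in> center"
      using ppow_add[of n 1 u] \<open>n > 0\<close> by (simp add: mult.assoc)
    with center_cancel[OF prime cen nz] u show False by blast
  qed
  have "ppow z (Suc n) = 0" for z :: 'a
  proof (cases "z \<in> center")
    case True
    \<comment> \<open>A central \<open>z\<close> is a limit of non-central points along the
      direction of the non-central \<open>x\<close>.\<close>
    have "z + t *\<^sub>R x \<notin> center" if "t \<noteq> 0" for t
    proof
      assume "z + t *\<^sub>R x \<in> center"
      then have "(1 / t) *\<^sub>R ((z + t *\<^sub>R x) - z) \<in> center"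
        using True by (intro subspace_scale subspace_diff subspace_center)
      then show False using x that by simp
    qed
    then have "ppow (z + t *\<^sub>R x) (Suc n) \<in> {0}" if "t \<noteq> 0" for t
      using that nil by blast
    moreover have "isCont (\<lambda>t. ppow (z + t *\<^sub>R x) (Suc n)) 0"
      by (intro poly_curve_continuous poly_curve_ppow poly_curve_line)
    ultimately have "ppow z (Suc n) \<in> {0}"
      using closed_tendsto_at[of "{0}" "\<lambda>t. ppow (z + t *\<^sub>R x) (Suc n)" "ppow z (Suc n)" 1]
      by (simp add: isCont_def)
    then show ?thesis by simp
  qed (rule nil)
  then have "x = 0" by (rule nil_bounded_index_zero[OF prime])
  with x show False by (simp add: center_def)
qed

section \<open>Baire category and the reduction to fixed exponents\<close>

lemma Baire_closed_cover:
  fixes F :: "'i::countable \<Rightarrow> 'b::complete_space set"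
  assumes "open U" "U \<noteq> {}" "\<And>i. closed (F i)" "U \<subseteq> (\<Union>i. F i)"
  shows "\<exists>i. interior (F i) \<noteq> {}"
proof (rule ccontr)
  assume "\<not> ?thesis"
  then have "euclidean interior_of (\<Union>(range F)) = {}"
    using assms(3) completely_metrizable_space_euclidean
    by (intro Baire_category_alt) auto
  then show False
    using interior_maximal[OF assms(4,1)] assms(2) by simp
qed

theorem theorem2p4:
  fixes H1 H2 :: "'a::{real_normed_algebra, banach} set"
    and f :: "'a \<Rightarrow> 'a"
  assumes prime: "prime_ring TYPE('a)"
    and H1: "open H1" "H1 \<noteq> {}"
    and H2: "open H2" "H2 \<noteq> {}"
    and aut: "is_automorphism f"
    and cont: "continuous_on UNIV f"
    and cond: "\<forall>x\<in>H1. \<forall>y\<in>H2. \<exists>p q :: nat. p > 0 \<and> q > 0 \<and>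
                 f (ppow x p * ppow y q) - jordan_prod (ppow x p) (ppow y q) \<in> center"
  shows "\<forall>x y :: 'a. x * y = y * x"
proof -
  have lin: "linear f"
    using aut cont by (intro linear_continuous_additive) (simp_all add: is_automorphism_def)
  define \<Phi> where "\<Phi> p q x y = f (ppow x p * ppow y q) - jordan_prod (ppow x p) (ppow y q)"
    for p q x y
  \<comment> \<open>The shift by \<open>Suc\<close> keeps both exponents positive while the index
    ranges over all pairs of naturals.\<close>
  define F where "F = (\<lambda>(p, q). {z. \<Phi> (Suc p) (Suc q) (fst z) (snd z) \<in> center})"
  have "closed (F i)" for i
  proof -
    have "continuous_on UNIV (\<lambda>z. \<Phi> (Suc (fst i)) (Suc (snd i)) (fst z) (snd z))"
      unfolding \<Phi>_def jordan_prod_def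
      by (intro continuous_intros continuous_on_compose2[OF cont]) auto
    from closed_vimage[OF closed_center this] show ?thesis
      by (simp add: F_def case_prod_beta vimage_def)
  qed
  moreover have "H1 \<times> H2 \<subseteq> (\<Union>i. F i)"
  proof clarify
    fix x y assume "x \<in> H1" "y \<in> H2"
    with cond obtain p q where "p > 0" "q > 0" "\<Phi> p q x y \<in> center"
      unfolding \<Phi>_def by blast
    then have "(x, y) \<in> F (p - 1, q - 1)" by (simp add: F_def)
    then show "(x, y) \<in> (\<Union>i. F i)" by blast
  qed
  ultimately obtain i where "interior (F i) \<noteq> {}"
    using Baire_closed_cover[of "H1 \<times> H2" F] H1 H2 by (auto simp: open_Times)
  then obtain x0 y0 where "(x0, y0) \<in> interior (F i)" by auto
  then obtain A B where "open A" "open B" "(x0, y0) \<in> A \<times> B" "A \<times> B \<subseteq> interior (F i)"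
    by (rule open_prod_elim[OF open_interior])
  then have AB: "open A" "open B" "x0 \<in> A" "y0 \<in> B" "A \<times> B \<subseteq> F i"
    using interior_subset by blast+
  define p q where "p = Suc (fst i)" and "q = Suc (snd i)"
  have pq: "p > 0" "q > 0" by (simp_all add: p_def q_def)
  have local: "\<Phi> p q x y \<in> center" if "x \<in> A" "y \<in> B" for x y
    using AB(5) that by (auto simp: F_def p_def q_def case_prod_beta)
  have near: "\<exists>e>0. \<forall>t. \<bar>t\<bar> < e \<longrightarrow> a + t *\<^sub>R b \<in> U" if "open U" "a \<in> U" for a b :: 'a and U
  proof -
    have "open ((\<lambda>t. a + t *\<^sub>R b) -` U)"
      by (intro open_vimage that continuous_intros)
    moreover have "0 \<in> (\<lambda>t. a + t *\<^sub>R b) -` U" using that by simp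
    ultimately obtain e where "e > 0" "ball 0 e \<subseteq> (\<lambda>t. a + t *\<^sub>R b) -` U"
      by (rule openE)
    then show ?thesis by (intro exI[of _ e]) (auto simp: subset_iff)
  qed
  have curve: "poly_curve (\<lambda>t. \<Phi> p q (g t) (h t))"
    if "poly_curve g" "poly_curve h" for g h
    unfolding \<Phi>_def jordan_prod_def
    by (intro poly_curve_diff poly_curve_add poly_curve_mult poly_curve_linear[OF lin]
        poly_curve_ppow that)
  note ext = poly_curve_in_closed_subspace[OF closed_center subspace_center]
  \<comment> \<open>The box is left one variable at a time: first along the line from
    \<open>x0\<close> to \<open>x\<close>, reached at parameter 1, with \<open>y\<close> still in
    \<open>B\<close>.\<close>
  have half: "\<Phi> p q x y \<in> center" if "y \<in> B" for x y
  proof -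
    obtain e where "e > 0" "\<And>t. \<bar>t\<bar> < e \<Longrightarrow> x0 + t *\<^sub>R (x - x0) \<in> A"
      using near[OF AB(1,3)] by metis
    with ext[OF this(1) curve[OF poly_curve_line poly_curve.const], of x0 "x - x0" y 1]
    show ?thesis using local that by simp
  qed
  have all: "\<Phi> p q x y \<in> center" for x y
  proof -
    obtain e where "e > 0" "\<And>t. \<bar>t\<bar> < e \<Longrightarrow> y0 + t *\<^sub>R (y - y0) \<in> B"
      using near[OF AB(2,4)] by metis
    with ext[OF this(1) curve[OF poly_curve.const poly_curve_line], of x y0 "y - y0" 1]
    show ?thesis using half by simp
  qed
  obtain n where n: "p * q = Suc n" using pq by (metis mult_pos_pos gr0_implies_Suc)
  have pow: "f (ppow x (Suc n) * ppow y (Suc n)) - jordan_prod (ppow x (Suc n)) (ppow y (Suc n)) \<in> center"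
    for x y
    \<comment> \<open>Substituting \<open>ppow x q\<close> and \<open>ppow y p\<close> raises both
      variables to the common exponent \<open>p * q\<close>, so that they can be exchanged.\<close>
    using all[of "ppow x q" "ppow y p"] pq n mult.commute[of q p]
    by (simp only: \<Phi>_def ppow_ppow)
  have "ppow x (Suc n) * ppow y (Suc n) - ppow y (Suc n) * ppow x (Suc n) \<in> center" for x y :: 'a
  proof -
    define u v where "u = ppow x (Suc n)" and "v = ppow y (Suc n)"
    have "f (u * v) - jordan_prod u v - (f (v * u) - jordan_prod v u) \<in> center"
      unfolding u_def v_def by (intro subspace_diff subspace_center pow)
    then have "f (u * v - v * u) \<in> center"
      by (simp add: jordan_prod_def linear_diff[OF lin] algebra_simps)
    \<comment> \<open>Centrality pulls back along \<open>f\<close>: \<open>f w\<close> commutes with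
      each \<open>f r\<close>, and \<open>f\<close> is injective.\<close>
    moreover have "w \<in> center" if "f w \<in> center" for w
    proof -
      have "f (w * r) = f (r * w)" for r
        using centerD[OF that, of "f r"] aut by (simp add: is_automorphism_def)
      then have "w * r = r * w" for r
        using aut unfolding is_automorphism_def by (metis bij_pointE)
      then show ?thesis by (simp add: center_def)
    qed
    ultimately show ?thesis by (simp add: u_def v_def)
  qed
  from commutative_if_ppow_center[OF prime ppow_center_if_commutators_center[OF prime this]]
  show ?thesis using centerD by blast
qed

end
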